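(* Let $(X,d)$ be a locally complete metric space and let $\Phi:[0,\infty)\times X\times[0,1]\to X$ be a time dependent arc field on $X$ satisfying Conditions A, B and C (all written out in the context). Then for every $a\in X$ and every $t\in[0,\infty)$ there exist $c>0$ and a solution curve $\sigma:[t,t+c)\to X$ of $\Phi$ with initial position $a$ at time $t$; that is, $\sigma(t)=a$ and for every $s\in[t,t+c)$ $$\lim_{h\to 0^+}\frac{d\big(\sigma(s+h),\Phi^{s}_h(\sigma(s))\big)}{h}=0 .$$
   Context: Locally complete means that every point of $X$ has a neighbourhood that is complete in the induced metric. $B(x,r)$ is the open ball of radius $r$ about $x$. Time dependent arc field: a map $\Phi:[0,\infty)\times X\times[0,1]\to X$, written $\Phi^t_h(x):=\Phi(t;x,h)$, such that for all $t\in[0,\infty)$, $x\in X$: $\Phi(t;x,0)=x$, $\rho(x,t):=\sup_{h\ne k}\frac{d(\Phi(t;x,h),\Phi(t;x,k))}{|h-k|}<\infty$, and $\rho$ is locally bounded, i.e. for all $(x,t)$ there exist $r,l>0$ such that $\rho(x,t;r,l):=\sup\{\rho(y,s): y\in B(x,r),\ s\ge 0,\ |t-s|\le l\}<\infty$. Condition A: There is a function $\Lambda:X\times X\times[0,1]\to(-\infty,\infty)$ such that for each $a\in X$ and $t\in[0,\infty)$ there are constants $r_a>0$, $\epsilon_a\in(0,1]$ and $T_t>t$ such that $\Lambda$ is bounded above on $B(a,r_a)\times B(a,r_a)\times[0,\epsilon_a]$ and $$d(\Phi^s_h(a_1),\Phi^s_h(a_2))\le d(a_1,a_2)\,(1+h\Lambda(a_1,a_2,h))$$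 for all $a_1,a_2\in B(a,r_a)$, $h\in[0,\epsilon_a]$, $s\in[t,T_t]$. Condition B: There is a function $\Omega:X\times[0,1]\times[0,1]\to[0,\infty)$ such that for each $a\in X$ and $t\in[0,\infty)$ there are constants $r_a>0$, $\epsilon_a\in(0,1]$ and $T_t>t$ for which $\Omega$ is bounded on $B(a,r_a)\times[0,\epsilon_a]\times[0,\epsilon_a]$ and $$d(\Phi^s_{l+h}(b),\Phi^s_h\circ\Phi^s_l(b))\le h\,g(l,h)\,\Omega(b,l,h)$$ for all $b\in B(a,r_a)$, $l,h\in[0,\epsilon_a]$ (with $l+h\le 1$), $s\in[t,T_t]$, where $g:[0,\epsilon_a]\times[0,\epsilon_a]\to[0,\infty)$ satisfies $\lim_{l,h\to0^+}g(l,h)=0$ and $\sum_{i\in\mathbb{Z}^+,\,2^{-i}\le\epsilon_a}g(2^{-i},2^{-i})<\infty$. Condition C: For each $a\in X$ and $t\in[0,\infty)$ there are constants $r_a>0$, $\epsilon_a\in(0,1]$, $T_t>t$, $0<\alpha<1$ and $C>0$ such that $$d(\Phi^{s_1}_h(b),\Phi^{s_2}_h(b))\le C\,h\,|s_1-s_2|^\alpha$$ for all $b\in B(a,r_a)$, $h\in[0,\epsilon_a]$, $s_1,s_2\in[t,T_t]$. *)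

theory Defs
  imports "HOL-Analysis.Analysis"
begin

text \<open>
  The metric space \<open>X\<close> is the whole type \<open>'a\<close>. A map
  \<open>\<Phi> : [0,\<infinity>) \<times> X \<times> [0,1] \<rightarrow> X\<close> is represented by a total function, with
  \<open>\<Phi> t x h\<close> standing for \<open>\<Phi>\<^sup>t\<^sub>h(x)\<close>; only the values with
  \<open>t \<ge> 0\<close> and \<open>0 \<le> h \<le> 1\<close> are meaningful, and every condition below is restricted to them.
\<close>

text \<open>The supremum is taken in the extended reals, so that finiteness is a genuine condition.\<close>

definition arc_speed :: "(real \<Rightarrow> 'a::metric_space \<Rightarrow> real \<Rightarrow> 'a) \<Rightarrow> 'a \<Rightarrow> real \<Rightarrow> ereal" where
  "arc_speed \<Phi> x t =
     (SUP (h, k)\<in>{(h, k). h \<in> {0..1} \<and> k \<in> {0..1} \<and> h \<noteq> k}.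
        ereal (dist (\<Phi> t x h) (\<Phi> t x k) / \<bar>h - k\<bar>))"

definition local_arc_speed ::
  "(real \<Rightarrow> 'a::metric_space \<Rightarrow> real \<Rightarrow> 'a) \<Rightarrow> 'a \<Rightarrow> real \<Rightarrow> real \<Rightarrow> real \<Rightarrow> ereal" where
  "local_arc_speed \<Phi> x t r l =
     (SUP (y, s)\<in>ball x r \<times> {s. 0 \<le> s \<and> \<bar>t - s\<bar> \<le> l}. arc_speed \<Phi> y s)"

definition time_dependent_arc_field :: "(real \<Rightarrow> 'a::metric_space \<Rightarrow> real \<Rightarrow> 'a) \<Rightarrow> bool" where
  "time_dependent_arc_field \<Phi> \<longleftrightarrow>
     (\<forall>t\<ge>0. \<forall>x. \<Phi> t x 0 = x \<and> arc_speed \<Phi> x t < \<infinity> \<and>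
        (\<exists>r>0. \<exists>l>0. local_arc_speed \<Phi> x t r l < \<infinity>))"

definition condition_A :: "(real \<Rightarrow> 'a::metric_space \<Rightarrow> real \<Rightarrow> 'a) \<Rightarrow> bool" where
  "condition_A \<Phi> \<longleftrightarrow>
     (\<exists>\<Lambda> :: 'a \<Rightarrow> 'a \<Rightarrow> real \<Rightarrow> real.
        \<forall>a. \<forall>t\<ge>0. \<exists>r>0. \<exists>\<epsilon>\<in>{0<..1}. \<exists>T>t.
          bdd_above ((\<lambda>(x, y, h). \<Lambda> x y h) ` (ball a r \<times> ball a r \<times> {0..\<epsilon>})) \<and>
          (\<forall>a\<^sub>1\<in>ball a r. \<forall>a\<^sub>2\<in>ball a r. \<forall>h\<in>{0..\<epsilon>}. \<forall>s\<in>{t..T}.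
             dist (\<Phi> s a\<^sub>1 h) (\<Phi> s a\<^sub>2 h) \<le> dist a\<^sub>1 a\<^sub>2 * (1 + h * \<Lambda> a\<^sub>1 a\<^sub>2 h)))"

text \<open>
  The function \<open>\<Omega>\<close> is global, whereas \<open>g\<close>, whose domain involves the local
  constant \<open>\<epsilon>\<close>, may depend on \<open>a\<close> and \<open>t\<close>.
\<close>

definition condition_B :: "(real \<Rightarrow> 'a::metric_space \<Rightarrow> real \<Rightarrow> 'a) \<Rightarrow> bool" where
  "condition_B \<Phi> \<longleftrightarrow>
     (\<exists>\<Omega> :: 'a \<Rightarrow> real \<Rightarrow> real \<Rightarrow> real.
        (\<forall>x. \<forall>l\<in>{0..1}. \<forall>h\<in>{0..1}. 0 \<le> \<Omega> x l h) \<and>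
        (\<forall>a. \<forall>t\<ge>0. \<exists>r>0. \<exists>\<epsilon>\<in>{0<..1}. \<exists>T>t. \<exists>g :: real \<Rightarrow> real \<Rightarrow> real.
          bounded ((\<lambda>(x, l, h). \<Omega> x l h) ` (ball a r \<times> {0..\<epsilon>} \<times> {0..\<epsilon>})) \<and>
          (\<forall>l\<in>{0..\<epsilon>}. \<forall>h\<in>{0..\<epsilon>}. 0 \<le> g l h) \<and>
          ((\<lambda>(l, h). g l h) \<longlongrightarrow> 0) (at_right 0 \<times>\<^sub>F at_right 0) \<and>
          (\<lambda>i. g ((1/2) ^ i) ((1/2) ^ i)) summable_on {i::nat. 1 \<le> i \<and> (1/2) ^ i \<le> \<epsilon>} \<and>
          (\<forall>b\<in>ball a r. \<forall>l\<in>{0..\<epsilon>}. \<forall>h\<in>{0..\<epsilon>}. \<forall>s\<in>{t..T}. l + h \<le> 1 \<longrightarrow>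
             dist (\<Phi> s b (l + h)) (\<Phi> s (\<Phi> s b l) h) \<le> h * g l h * \<Omega> b l h)))"

definition condition_C :: "(real \<Rightarrow> 'a::metric_space \<Rightarrow> real \<Rightarrow> 'a) \<Rightarrow> bool" where
  "condition_C \<Phi> \<longleftrightarrow>
     (\<forall>a. \<forall>t\<ge>0. \<exists>r>0. \<exists>\<epsilon>\<in>{0<..1}. \<exists>T>t. \<exists>\<alpha>\<in>{0<..<1}. \<exists>C>0.
        \<forall>b\<in>ball a r. \<forall>h\<in>{0..\<epsilon>}. \<forall>s\<^sub>1\<in>{t..T}. \<forall>s\<^sub>2\<in>{t..T}.
          dist (\<Phi> s\<^sub>1 b h) (\<Phi> s\<^sub>2 b h) \<le> C * h * \<bar>s\<^sub>1 - s\<^sub>2\<bar> powr \<alpha>)"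

text \<open>
  A solution curve on \<open>[t, t + c)\<close>. Only the values of \<open>\<sigma>\<close> on this interval matter, since
  \<open>s + h\<close> lies in it for all small \<open>h > 0\<close>.
\<close>

definition solution_curve ::
  "(real \<Rightarrow> 'a::metric_space \<Rightarrow> real \<Rightarrow> 'a) \<Rightarrow> 'a \<Rightarrow> real \<Rightarrow> real \<Rightarrow> (real \<Rightarrow> 'a) \<Rightarrow> bool" where
  "solution_curve \<Phi> a t c \<sigma> \<longleftrightarrow>
     \<sigma> t = a \<and>
     (\<forall>s\<in>{t..<t + c}. ((\<lambda>h. dist (\<sigma> (s + h)) (\<Phi> s (\<sigma> s) h) / h) \<longlongrightarrow> 0) (at_right 0))"

definition locally_complete :: "'a::metric_space set \<Rightarrow> bool" where
  "locally_complete S \<longleftrightarrow>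
     (\<forall>x\<in>S. \<exists>N\<subseteq>S. complete N \<and> (\<exists>U. openin (top_of_set S) U \<and> x \<in> U \<and> U \<subseteq> N))"

end

theory Submission
  imports Defs
begin

text \<open>
  Let \<open>euler n j\<close> be the Euler polygon with step \<open>2\<^sup>-\<^sup>n\<close>. Condition B with one
  argument equal to the step, Condition C and a discrete Gronwall argument based on Condition A show
  that, uniformly in \<open>n\<close>, the polygon started at a node differs after time \<open>h\<close> from
  \<open>\<Phi>\<^sub>h\<close> of that node by \<open>o(h)\<close>. Using this for the nodes of a coarse polygon and a
  second Gronwall argument, the polygons form a uniform Cauchy sequence; letting \<open>n\<close> tend to
  infinity, the estimate itself becomes tangency of the limit curve to \<open>\<Phi>\<close>.
\<close>

section \<open>Discrete Gronwall inequality\<close>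

text \<open>By induction, \<open>u k\<close> is at most \<open>(1 + \<eta> * L) ^ k\<close> times
  the accumulated error \<open>k * \<eta> * \<delta>\<close>: since the growth factor is at least 1,
  each new error may be multiplied by the current power. The power is at most \<open>exp L\<close>
  because the total time \<open>m * \<eta>\<close> is at most 1. That time is kept as a factor of
  the bound, as an \<open>o(h)\<close> estimate requires.\<close>

lemma discrete_gronwall:
  fixes u :: "nat \<Rightarrow> real"
  assumes "u 0 \<le> 0" "0 \<le> \<eta>" "0 \<le> L" "0 \<le> \<delta>" "real m * \<eta> \<le> 1"
    and step: "\<And>k. k < m \<Longrightarrow> u (Suc k) \<le> (1 + \<eta> * L) * u k + \<eta> * \<delta>"
  shows "u m \<le> exp L * \<delta> * (real m * \<eta>)"
proof -
  have pow: "u k \<le> (1 + \<eta> * L) ^ k * (real k * \<eta> * \<delta>)" if "k \<le> m" for k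
    using that
  proof (induction k)
    case 0
    then show ?case using assms by simp
  next
    case (Suc k)
    have "u (Suc k) \<le> (1 + \<eta> * L) * u k + \<eta> * \<delta>"
      using Suc step by simp
    also have "\<dots> \<le> (1 + \<eta> * L) * ((1 + \<eta> * L) ^ k * (real k * \<eta> * \<delta>)) + (1 + \<eta> * L) ^ Suc k * (\<eta> * \<delta>)"
    proof (rule add_mono)
      show "(1 + \<eta> * L) * u k \<le> (1 + \<eta> * L) * ((1 + \<eta> * L) ^ k * (real k * \<eta> * \<delta>))"
        using Suc assms by (intro mult_left_mono) auto
      have "1 \<le> (1 + \<eta> * L) ^ Suc k"
        using assms by (intro one_le_power) auto
      then show "\<eta> * \<delta> \<le> (1 + \<eta> * L) ^ Suc k * (\<eta> * \<delta>)"
        using assms mult_right_mono[of 1 "(1 + \<eta> * L) ^ Suc k" "\<eta> * \<delta>"] by simp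
    qed
    also have "\<dots> = (1 + \<eta> * L) ^ Suc k * (real (Suc k) * \<eta> * \<delta>)"
      by (simp add: algebra_simps)
    finally show ?case .
  qed
  have "(1 + \<eta> * L) ^ m \<le> exp (\<eta> * L) ^ m"
    using assms by (intro power_mono exp_ge_add_one_self) auto
  also have "\<dots> = exp (real m * \<eta> * L)"
    by (simp add: exp_of_nat_mult mult.assoc)
  also have "\<dots> \<le> exp L"
    using assms mult_right_mono[of "real m * \<eta>" 1 L] by simp
  finally have "(1 + \<eta> * L) ^ m * (real m * \<eta> * \<delta>) \<le> exp L * (real m * \<eta> * \<delta>)"
    using assms by (intro mult_right_mono) auto
  with pow[of m] show ?thesis
    by (simp add: mult_ac)
qed

section \<open>Uniform local estimates and Euler polygons\<close>

text \<open>
  The constants of the three conditions, shrunk to a common ball and time interval. In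
  \<open>defect\<close> the step \<open>l\<close> must be positive, because the limit in Condition B says
  nothing about \<open>g 0 h\<close>.
\<close>

locale uniform_arc_field =
  fixes \<Phi> :: "real \<Rightarrow> 'a::metric_space \<Rightarrow> real \<Rightarrow> 'a" and a :: 'a and t r e R L :: real and N :: "'a set"
  assumes pos: "0 < r" "0 < e" "e \<le> 1" "0 < R" "0 \<le> L"
    and room: "R * e \<le> r / 2"
    and start: "\<And>s x. t \<le> s \<Longrightarrow> \<Phi> s x 0 = x"
    and speed: "\<And>s x h k. \<lbrakk>x \<in> ball a r; s \<in> {t..t + e}; h \<in> {0..1}; k \<in> {0..1}\<rbrakk> \<Longrightarrow>
        dist (\<Phi> s x h) (\<Phi> s x k) \<le> R * \<bar>h - k\<bar>"
    and lip: "\<And>s x y h. \<lbrakk>x \<in> ball a r; y \<in> ball a r; s \<in> {t..t + e}; h \<in> {0..e}\<rbrakk> \<Longrightarrow>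
        dist (\<Phi> s x h) (\<Phi> s y h) \<le> (1 + h * L) * dist x y"
    and defect: "\<And>\<delta>. 0 < \<delta> \<Longrightarrow> \<exists>h0>0. \<forall>x\<in>ball a r. \<forall>s\<in>{t..t + e}. \<forall>l\<in>{0<..<h0}. \<forall>h\<in>{0<..<h0}.
        dist (\<Phi> s x (l + h)) (\<Phi> s (\<Phi> s x l) h) \<le> h * \<delta>"
    and time: "\<And>\<delta>. 0 < \<delta> \<Longrightarrow> \<exists>h0>0. \<forall>x\<in>ball a r. \<forall>h\<in>{0..e}. \<forall>s1\<in>{t..t + e}. \<forall>s2\<in>{t..t + e}.
        \<bar>s1 - s2\<bar> < h0 \<longrightarrow> dist (\<Phi> s1 x h) (\<Phi> s2 x h) \<le> h * \<delta>"
    and complete: "complete N" "ball a r \<subseteq> N"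
begin

text \<open>Node \<open>j\<close> belongs to time \<open>t + j / 2 ^ n\<close>, and each step
  freezes the time at its left end. With dyadic steps, every node time of a coarse grid is also a
  node time of all finer grids, so polygons can be compared at equal times.\<close>

primrec euler :: "nat \<Rightarrow> nat \<Rightarrow> 'a" where
  "euler n 0 = a"
| "euler n (Suc j) = \<Phi> (t + real j / 2 ^ n) (euler n j) (1 / 2 ^ n)"

text \<open>By \<open>room\<close>, motion at speed \<open>R\<close> during time \<open>e\<close>
  covers at most half the radius. This is what keeps polygons and arcs inside the ball where the
  estimates hold.\<close>

lemma ball_if_speed: "dist a x \<le> R * s \<Longrightarrow> s \<le> e \<Longrightarrow> x \<in> ball a r"
  using pos room mult_left_mono[of s e R] unfolding mem_ball by linarith

lemma node_in: "real j / 2 ^ n \<le> e \<Longrightarrow> t + real j / 2 ^ n \<in> {t..t + e}"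
  by simp

lemma node_Suc: "real (Suc j) / 2 ^ n \<le> e \<Longrightarrow> real j / 2 ^ n \<le> e"
  by (simp add: field_simps)

text \<open>The distance bound is itself the induction invariant: \<open>speed\<close> applies to
  the next step only once the current node is known to lie in the ball.\<close>

lemma euler_dist: "real j / 2 ^ n \<le> e \<Longrightarrow> dist a (euler n j) \<le> R * (real j / 2 ^ n)"
proof (induction j)
  case (Suc j)
  then have IH: "dist a (euler n j) \<le> R * (real j / 2 ^ n)" and j: "real j / 2 ^ n \<le> e"
    using node_Suc by blast+
  have "dist (\<Phi> (t + real j / 2 ^ n) (euler n j) 0) (euler n (Suc j)) \<le> R * \<bar>0 - 1 / 2 ^ n\<bar>"
    using speed[OF ball_if_speed[OF IH j] node_in[OF j], of 0 "1 / 2 ^ n"] by simp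
  then have "dist (euler n j) (euler n (Suc j)) \<le> R * (1 / 2 ^ n)"
    by (simp add: start)
  with IH have "dist a (euler n (Suc j)) \<le> R * (real j / 2 ^ n) + R * (1 / 2 ^ n)"
    using dist_triangle[of a "euler n (Suc j)" "euler n j"] by linarith
  then show ?case
    by (simp add: field_simps)
qed simp

lemma euler_in_ball: "real j / 2 ^ n \<le> e \<Longrightarrow> euler n j \<in> ball a r"
  using euler_dist ball_if_speed by blast

lemma euler_lipschitz:
  "real (i + q) / 2 ^ n \<le> e \<Longrightarrow> dist (euler n i) (euler n (i + q)) \<le> R * (real q / 2 ^ n)"
proof (induction q)
  case (Suc q)
  then have j: "real (i + q) / 2 ^ n \<le> e"
    using node_Suc[of "i + q" n] by simp
  have "dist (\<Phi> (t + real (i + q) / 2 ^ n) (euler n (i + q)) 0) (euler n (i + Suc q)) \<le> R * \<bar>0 - 1 / 2 ^ n\<bar>"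
    using speed[OF euler_in_ball[OF j] node_in[OF j], of 0 "1 / 2 ^ n"] by simp
  then have "dist (euler n (i + q)) (euler n (i + Suc q)) \<le> R * (1 / 2 ^ n)"
    by (simp add: start)
  with Suc.IH[OF j] have "dist (euler n i) (euler n (i + Suc q)) \<le> R * (real q / 2 ^ n) + R * (1 / 2 ^ n)"
    using dist_triangle[of "euler n i" "euler n (i + Suc q)" "euler n (i + q)"] by linarith
  then show ?case
    by (simp add: field_simps)
qed simp

section \<open>Uniform tangency and comparison of step sizes\<close>

lemma euler_tangent:
  assumes "0 < \<delta>"
  shows "\<exists>h0>0. \<forall>n i m. real (i + m) / 2 ^ n \<le> e \<longrightarrow> real m / 2 ^ n < h0 \<longrightarrow>
    dist (\<Phi> (t + real i / 2 ^ n) (euler n i) (real m / 2 ^ n)) (euler n (i + m)) \<le> \<delta> * (real m / 2 ^ n)"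
proof -
  \<comment> \<open>Two errors of size \<open>\<gamma>\<close> per unit time, one from
    \<open>defect\<close> and one from \<open>time\<close>, are amplified by \<open>exp L\<close>;
    this choice makes the total exactly \<open>\<delta>\<close>.\<close>
  define \<gamma> where "\<gamma> = \<delta> / (2 * exp L)"
  have \<gamma>: "0 < \<gamma>" "exp L * (2 * \<gamma>) = \<delta>"
    using assms by (simp_all add: \<gamma>_def)
  obtain h1 where h1: "h1 > 0" "\<And>x s l h. \<lbrakk>x \<in> ball a r; s \<in> {t..t + e}; l \<in> {0<..<h1}; h \<in> {0<..<h1}\<rbrakk> \<Longrightarrow>
      dist (\<Phi> s x (l + h)) (\<Phi> s (\<Phi> s x l) h) \<le> h * \<gamma>"
    using defect[OF \<gamma>(1)] by blast
  obtain h2 where h2: "h2 > 0" "\<And>x h s1 s2. \<lbrakk>x \<in> ball a r; h \<in> {0..e}; s1 \<in> {t..t + e}; s2 \<in> {t..t + e}; \<bar>s1 - s2\<bar> < h2\<rbrakk> \<Longrightarrow>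
      dist (\<Phi> s1 x h) (\<Phi> s2 x h) \<le> h * \<gamma>"
    using time[OF \<gamma>(1)] by blast
  have main: "dist (\<Phi> (t + real i / 2 ^ n) (euler n i) (real m / 2 ^ n)) (euler n (i + m)) \<le> \<delta> * (real m / 2 ^ n)"
    if im: "real (i + m) / 2 ^ n \<le> e" and m: "real m / 2 ^ n < min h1 h2" for n i m
  proof -
    define \<eta> where "\<eta> = (1 :: real) / 2 ^ n"
    define s where "s = t + real i * \<eta>"
    define x where "x = euler n i"
    define z where "z k = \<Phi> s x (real k * \<eta>)" for k
    define u where "u k = dist (z k) (euler n (i + k))" for k
    have \<eta>: "0 < \<eta>" by (simp add: \<eta>_def)
    have div: "real k / 2 ^ n = real k * \<eta>" for k by (simp add: \<eta>_def)
    have le: "real (i + k) * \<eta> \<le> e" "real k * \<eta> \<le> e" "real k * \<eta> \<le> 1" "real k * \<eta> < min h1 h2" if "k \<le> m" for k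
    proof -
      have "real (i + k) * \<eta> \<le> real (i + m) * \<eta>" "real k * \<eta> \<le> real m * \<eta>" "real k * \<eta> \<le> real (i + k) * \<eta>"
        using that \<eta> by (auto intro!: mult_right_mono)
      then show "real (i + k) * \<eta> \<le> e" "real k * \<eta> \<le> e" "real k * \<eta> \<le> 1" "real k * \<eta> < min h1 h2"
        using im m pos unfolding div by linarith+
    qed
    have x: "x \<in> ball a r" "dist a x \<le> R * (real i * \<eta>)"
      using le(1)[of 0] euler_in_ball[of i n] euler_dist[of i n] by (auto simp: x_def div)
    have s: "s \<in> {t..t + e}"
      using le(1)[of 0] \<eta> by (simp add: s_def)
    have z0: "z 0 = x"
      using start s by (simp add: z_def)
    \<comment> \<open>The arc starts at an already displaced node, so the two displacements are
      added and charged to the total elapsed time \<open>(i + k) * \<eta>\<close>, which is still at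
      most \<open>e\<close>.\<close>
    have z: "z k \<in> ball a r" if "k \<le> m" for k
    proof -
      have "dist x (z k) \<le> R * (real k * \<eta>)"
        using speed[OF x(1) s, of 0 "real k * \<eta>"] le[OF that] z0 \<eta> by (simp add: z_def)
      then have "dist a (z k) \<le> R * (real i * \<eta>) + R * (real k * \<eta>)"
        using x(2) dist_triangle[of a "z k" x] by linarith
      then have "dist a (z k) \<le> R * (real (i + k) * \<eta>)"
        by (simp add: algebra_simps)
      then show ?thesis
        using ball_if_speed le[OF that] by blast
    qed
    have "u m \<le> exp L * (2 * \<gamma>) * (real m * \<eta>)"
    proof (rule discrete_gronwall)
      show "u 0 \<le> 0" by (simp add: u_def z0 x_def)
      show "u (Suc k) \<le> (1 + \<eta> * L) * u k + \<eta> * (2 * \<gamma>)" if "k < m" for k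
      \<comment> \<open>The first step is treated apart because \<open>defect\<close> demands a
        positive first time. Here arc and polygon make the same move, so the distance after it is
        zero.\<close>
      proof (cases "k = 0")
        case True
        have "u (Suc 0) = 0"
          by (simp add: u_def z_def x_def s_def \<eta>_def)
        then show ?thesis
          using True \<open>u 0 \<le> 0\<close> \<eta> \<gamma> pos by (simp add: u_def)
      next
        case False
        define s' where "s' = t + real (i + k) * \<eta>"
        have k: "k \<le> m" "Suc k \<le> m" "1 \<le> m" using that by auto
        have s': "s' \<in> {t..t + e}"
          using le(1)[OF k(1)] \<eta> by (simp add: s'_def)
        have \<eta>_le: "\<eta> \<in> {0..e}" "\<eta> \<in> {0<..<h1}"
          using le[OF k(3)] \<eta> by auto
        have k\<eta>: "real k * \<eta> \<in> {0<..<h1}"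
          using le[OF k(1)] \<eta> False by auto
        have eul: "euler n (i + Suc k) = \<Phi> s' (euler n (i + k)) \<eta>"
          by (simp add: s'_def \<eta>_def)
        have zS: "z (Suc k) = \<Phi> s x (real k * \<eta> + \<eta>)"
          by (simp add: z_def algebra_simps)
        have d1: "dist (z (Suc k)) (\<Phi> s (z k) \<eta>) \<le> \<eta> * \<gamma>"
          using h1(2)[OF x(1) s k\<eta> \<eta>_le(2)] unfolding zS by (simp add: z_def)
        \<comment> \<open>The two frozen times differ by \<open>k * \<eta>\<close>, which is bounded
          by the elapsed time \<open>m * \<eta>\<close>.\<close>
        have "\<bar>s - s'\<bar> < h2"
          using le[OF k(1)] \<eta> by (simp add: s_def s'_def algebra_simps)
        then have d2: "dist (\<Phi> s (z k) \<eta>) (\<Phi> s' (z k) \<eta>) \<le> \<eta> * \<gamma>"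
          using h2(2)[OF z[OF k(1)] \<eta>_le(1) s s'] by simp
        have "euler n (i + k) \<in> ball a r"
          using euler_in_ball[of "i + k" n] le(1)[OF k(1)] by (simp only: div)
        then have d3: "dist (\<Phi> s' (z k) \<eta>) (euler n (i + Suc k)) \<le> (1 + \<eta> * L) * u k"
          using lip[OF z[OF k(1)] _ s' \<eta>_le(1)] unfolding eul by (simp add: u_def)
        show ?thesis
          using d1 d2 d3 dist_triangle[of "z (Suc k)" "euler n (i + Suc k)" "\<Phi> s (z k) \<eta>"]
            dist_triangle[of "\<Phi> s (z k) \<eta>" "euler n (i + Suc k)" "\<Phi> s' (z k) \<eta>"]
          unfolding u_def by (simp add: algebra_simps)
      qed
    qed (use \<eta> \<gamma> pos le[of m] in auto)
    then show ?thesis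
      unfolding \<gamma>(2) by (simp add: u_def z_def x_def s_def div)
  qed
  show ?thesis
    using main h1(1) h2(1) by (intro exI[of _ "min h1 h2"]) auto
qed

text \<open>One coarse step is a single application of \<open>\<Phi>\<close>, which
  \<open>lip\<close> controls under a change of starting point. Begun at a node of the fine polygon,
  it misses the fine polygon by at most \<open>\<gamma> * \<eta>\<close>, by uniform tangency.
  Gronwall over the coarse steps gives a bound independent of \<open>p\<close>; \<open>M\<close>
  only has to make one coarse step shorter than the tangency threshold.\<close>

lemma euler_refine:
  assumes "0 < \<delta>"
  shows "\<exists>M. \<forall>n\<ge>M. \<forall>p j. real j / 2 ^ n \<le> e \<longrightarrow> dist (euler n j) (euler (n + p) (j * 2 ^ p)) \<le> \<delta>"
proof -
  define \<gamma> where "\<gamma> = \<delta> / exp L"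
  have \<gamma>: "0 < \<gamma>" "exp L * \<gamma> = \<delta>"
    using assms by (simp_all add: \<gamma>_def)
  obtain h0 where h0: "h0 > 0" "\<And>n i m. \<lbrakk>real (i + m) / 2 ^ n \<le> e; real m / 2 ^ n < h0\<rbrakk> \<Longrightarrow>
      dist (\<Phi> (t + real i / 2 ^ n) (euler n i) (real m / 2 ^ n)) (euler n (i + m)) \<le> \<gamma> * (real m / 2 ^ n)"
    using euler_tangent[OF \<gamma>(1)] by blast
  obtain M where M: "(1 / 2 :: real) ^ M < h0"
    using real_arch_pow_inv[OF h0(1), of "1 / 2"] by auto
  have main: "dist (euler n j) (euler (n + p) (j * 2 ^ p)) \<le> \<delta>"
    if "M \<le> n" and j: "real j / 2 ^ n \<le> e" for n p j
  proof -
    define \<eta> where "\<eta> = (1 :: real) / 2 ^ n"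
    have \<eta>: "0 < \<eta>" by (simp add: \<eta>_def)
    have div: "real k / 2 ^ n = real k * \<eta>" for k by (simp add: \<eta>_def)
    have "\<eta> \<le> (1 / 2) ^ M"
      using power_decreasing[OF that(1), of "1 / 2 :: real"] by (simp add: \<eta>_def power_one_over)
    with M have \<eta>_less: "\<eta> < h0" by simp
    \<comment> \<open>Coarse node \<open>k\<close> and fine node \<open>k * 2 ^ p\<close> carry the
      same time, and \<open>2 ^ p\<close> fine steps make up one coarse step.\<close>
    have fine: "real (k * 2 ^ p) / 2 ^ (n + p) = real k * \<eta>" for k
      by (simp add: \<eta>_def power_add)
    have finer: "real (k * 2 ^ p + 2 ^ p) / 2 ^ (n + p) = real (Suc k) * \<eta>" for k
      using fine[of "Suc k"] by (simp add: algebra_simps)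
    have fine1: "real (2 ^ p) / 2 ^ (n + p) = \<eta>"
      using fine[of 1] by simp
    have "dist (euler n j) (euler (n + p) (j * 2 ^ p)) \<le> exp L * \<gamma> * (real j * \<eta>)"
    proof (rule discrete_gronwall[where u = "\<lambda>k. dist (euler n k) (euler (n + p) (k * 2 ^ p))"])
      fix k assume "k < j"
      then have "real (Suc k) * \<eta> \<le> real j * \<eta>"
        using \<eta> by (intro mult_right_mono) auto
      then have Suck: "real (Suc k) * \<eta> \<le> e"
        using j unfolding div by linarith
      moreover have "real (Suc k) * \<eta> = real k * \<eta> + \<eta>" "0 \<le> real k * \<eta>"
        using \<eta> by (simp_all add: algebra_simps)
      ultimately have k: "real k * \<eta> \<le> e" "\<eta> \<le> e"
        using \<eta> by linarith+
      define s where "s = t + real k * \<eta>"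
      define y where "y = euler (n + p) (k * 2 ^ p)"
      have "y \<in> ball a r" "euler n k \<in> ball a r"
        using k euler_in_ball[of "k * 2 ^ p" "n + p"] euler_in_ball[of k n]
        unfolding y_def fine div by blast+
      then have A: "dist (\<Phi> s (euler n k) \<eta>) (\<Phi> s y \<eta>) \<le> (1 + \<eta> * L) * dist (euler n k) y"
        using lip[of "euler n k" y s \<eta>] k \<eta> by (simp add: s_def)
      \<comment> \<open>Tangency is used for the fine polygon, over a block of \<open>2 ^ p\<close>
        steps.\<close>
      have "dist (\<Phi> s y \<eta>) (euler (n + p) (k * 2 ^ p + 2 ^ p)) \<le> \<gamma> * \<eta>"
        using h0(2)[of "k * 2 ^ p" "2 ^ p" "n + p"] Suck \<eta>_less
        unfolding finer fine fine1 s_def y_def by blast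
      then have B: "dist (\<Phi> s y \<eta>) (euler (n + p) (Suc k * 2 ^ p)) \<le> \<eta> * \<gamma>"
        by (simp add: mult.commute add.commute)
      have C: "euler n (Suc k) = \<Phi> s (euler n k) \<eta>"
        by (simp add: s_def \<eta>_def)
      show "dist (euler n (Suc k)) (euler (n + p) (Suc k * 2 ^ p))
          \<le> (1 + \<eta> * L) * dist (euler n k) (euler (n + p) (k * 2 ^ p)) + \<eta> * \<gamma>"
        using dist_triangle[of "\<Phi> s (euler n k) \<eta>" "euler (n + p) (Suc k * 2 ^ p)" "\<Phi> s y \<eta>"] A B
        unfolding C y_def by linarith
    qed (use \<eta> \<gamma> pos j in \<open>auto simp: div\<close>)
    also have "\<dots> \<le> \<delta> * 1"
      using j pos assms unfolding \<gamma>(2) div by (intro mult_left_mono) auto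
    finally show ?thesis by simp
  qed
  show ?thesis using main by blast
qed

section \<open>Dyadic rounding of times and the limit curve\<close>

text \<open>For \<open>s\<close> not before \<open>t\<close>, this is the last node of the grid at
  or before time \<open>s\<close>.\<close>

definition idx :: "nat \<Rightarrow> real \<Rightarrow> nat" where
  "idx n s = nat \<lfloor>(s - t) * 2 ^ n\<rfloor>"

lemma idx_bounds:
  assumes "t \<le> s"
  shows "real (idx n s) / 2 ^ n \<le> s - t" "s - t < real (idx n s) / 2 ^ n + 1 / 2 ^ n"
proof -
  have "real (idx n s) = of_int \<lfloor>(s - t) * 2 ^ n\<rfloor>"
    using assms by (simp add: idx_def)
  then have "real (idx n s) \<le> (s - t) * 2 ^ n" "(s - t) * 2 ^ n < real (idx n s) + 1"
    by linarith+
  then show "real (idx n s) / 2 ^ n \<le> s - t" "s - t < real (idx n s) / 2 ^ n + 1 / 2 ^ n"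
    by (simp_all add: field_simps)
qed

lemma idx_tendsto:
  assumes "t \<le> s"
  shows "(\<lambda>n. real (idx n s) / 2 ^ n) \<longlonglongrightarrow> s - t"
proof (rule tendsto_sandwich[where f = "\<lambda>n. s - t - (1 / 2) ^ n" and h = "\<lambda>n. s - t"])
  show "(\<lambda>n. s - t - (1 / 2) ^ n) \<longlonglongrightarrow> s - t"
    using tendsto_diff[OF tendsto_const LIMSEQ_power_zero[of "1 / 2 :: real"], of "s - t"] by simp
  show "\<forall>\<^sub>F n in sequentially. s - t - (1 / 2) ^ n \<le> real (idx n s) / 2 ^ n"
    using idx_bounds(2)[OF assms] by (intro always_eventually allI) (smt (verit) power_one_over)
  show "\<forall>\<^sub>F n in sequentially. real (idx n s) / 2 ^ n \<le> s - t"
    using idx_bounds(1)[OF assms] by simp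
qed simp

lemma idx_mono: "s \<le> s' \<Longrightarrow> idx n s \<le> idx n s'"
  unfolding idx_def by (intro nat_mono floor_mono mult_right_mono) auto

text \<open>Both rounded times lie at or below \<open>s\<close>, the coarse one by less than a
  coarse step and the fine one by less than a fine step. Clearing denominators gives strict
  inequalities between integers, hence the bounds on indices.\<close>

lemma idx_refine:
  assumes "t \<le> s"
  shows "idx n s * 2 ^ p \<le> idx (n + p) s" "idx (n + p) s - idx n s * 2 ^ p < 2 ^ p"
proof -
  have "real (idx n s) \<le> (s - t) * 2 ^ n" "(s - t) * 2 ^ n < real (idx n s) + 1"
    using idx_bounds[OF assms, of n] by (simp_all add: field_simps)
  then have "real (idx n s) * 2 ^ p \<le> (s - t) * 2 ^ n * 2 ^ p" "(s - t) * 2 ^ n * 2 ^ p < (real (idx n s) + 1) * 2 ^ p"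
    by (auto intro!: mult_right_mono mult_strict_right_mono)
  moreover have "real (idx (n + p) s) \<le> (s - t) * 2 ^ n * 2 ^ p" "(s - t) * 2 ^ n * 2 ^ p < real (idx (n + p) s) + 1"
    using idx_bounds[OF assms, of "n + p"] by (simp_all add: field_simps power_add)
  ultimately have "real (idx n s * 2 ^ p) < real (idx (n + p) s + 1)" "real (idx (n + p) s) < real (idx n s * 2 ^ p + 2 ^ p)"
    by (simp_all add: algebra_simps)
  then have "idx n s * 2 ^ p < idx (n + p) s + 1" "idx (n + p) s < idx n s * 2 ^ p + 2 ^ p"
    unfolding of_nat_less_iff by blast+
  then show "idx n s * 2 ^ p \<le> idx (n + p) s" "idx (n + p) s - idx n s * 2 ^ p < 2 ^ p"
    by linarith+
qed

text \<open>A step function suffices: it evaluates the polygon only at nodes, and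
  \<open>euler_lipschitz\<close> bridges the gaps caused by rounding.\<close>

definition approx :: "nat \<Rightarrow> real \<Rightarrow> 'a" where
  "approx n s = euler n (idx n s)"

text \<open>Two grids disagree at \<open>s\<close> for two reasons. Different polygons are followed
  up to the coarse node, which \<open>euler_refine\<close> controls, and the fine polygon then runs
  on for less than one coarse step, which \<open>euler_lipschitz\<close> controls.\<close>

lemma approx_Cauchy:
  assumes s: "s \<in> {t..t + e}"
  shows "Cauchy (\<lambda>n. approx n s)"
proof (rule metric_CauchyI)
  fix \<epsilon> :: real assume "0 < \<epsilon>"
  then have \<epsilon>: "0 < \<epsilon> / 8" "0 < \<epsilon> / (8 * R)" using pos by auto
  obtain M1 where M1: "\<And>n p j. \<lbrakk>M1 \<le> n; real j / 2 ^ n \<le> e\<rbrakk> \<Longrightarrow>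
      dist (euler n j) (euler (n + p) (j * 2 ^ p)) \<le> \<epsilon> / 8"
    using euler_refine[OF \<epsilon>(1)] by blast
  obtain M2 where M2: "(1 / 2 :: real) ^ M2 < \<epsilon> / (8 * R)"
    using real_arch_pow_inv[OF \<epsilon>(2), of "1 / 2"] by auto
  define M where "M = max M1 M2"
  have node: "real (idx n s) / 2 ^ n \<le> e" for n
    using idx_bounds(1)[of s n] s by auto
  have near: "dist (approx M s) (approx (M + p) s) \<le> \<epsilon> / 4" for p
  proof -
    \<comment> \<open>The coarse node in fine numbering; \<open>q\<close> counts the fine steps
      left, and \<open>idx_refine\<close> makes the natural-number subtraction exact.\<close>
    define i where "i = idx M s * 2 ^ p"
    define q where "q = idx (M + p) s - i"
    have q: "idx (M + p) s = i + q" "q < 2 ^ p"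
      using idx_refine[of s M p] s by (auto simp: i_def q_def)
    have "dist (approx M s) (euler (M + p) i) \<le> \<epsilon> / 8"
      unfolding approx_def i_def by (intro M1 node) (simp add: M_def)
    moreover have "dist (euler (M + p) i) (approx (M + p) s) \<le> R * (real q / 2 ^ (M + p))"
      using euler_lipschitz[of i q "M + p"] node[of "M + p"] by (simp add: approx_def q(1))
    moreover have "real q / 2 ^ (M + p) \<le> \<epsilon> / (8 * R)"
    proof -
      have "real q \<le> 2 ^ p"
        using q(2) by (metis less_imp_le of_nat_le_iff of_nat_numeral of_nat_power)
      then have "real q / 2 ^ (M + p) \<le> (1 / 2) ^ M"
        by (simp add: power_add field_simps)
      also have "\<dots> \<le> (1 / 2) ^ M2"
        by (intro power_decreasing) (auto simp: M_def)
      finally show ?thesis using M2 by simp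
    qed
    then have "R * (real q / 2 ^ (M + p)) \<le> \<epsilon> / 8"
      using pos mult_left_mono[of "real q / 2 ^ (M + p)" "\<epsilon> / (8 * R)" R] by simp
    ultimately show ?thesis
      using dist_triangle[of "approx M s" "approx (M + p) s" "euler (M + p) i"] by linarith
  qed
  have "dist (approx m s) (approx n s) < \<epsilon>" if "M \<le> m" "M \<le> n" for m n
    using near[of "m - M"] near[of "n - M"] that \<open>0 < \<epsilon>\<close>
      dist_triangle3[of "approx m s" "approx n s" "approx M s"] by simp
  then show "\<exists>M. \<forall>m\<ge>M. \<forall>n\<ge>M. dist (approx m s) (approx n s) < \<epsilon>" by blast
qed

text \<open>The closed ball of half the radius is what survives the passage to the limit, so the
  limit stays in the open ball of radius \<open>r\<close>.\<close>

lemma approx_in_cball: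
  assumes s: "s \<in> {t..t + e}"
  shows "approx n s \<in> cball a (r / 2)"
proof -
  have j: "real (idx n s) / 2 ^ n \<le> e"
    using idx_bounds(1)[of s n] s by auto
  have "dist a (approx n s) \<le> R * (real (idx n s) / 2 ^ n)"
    unfolding approx_def using euler_dist[OF j] .
  also have "\<dots> \<le> R * e"
    using j pos by (intro mult_left_mono) auto
  finally show ?thesis using room by simp
qed

lemma approx_convergent:
  assumes s: "s \<in> {t..t + e}"
  shows "\<exists>x\<in>ball a r. (\<lambda>n. approx n s) \<longlonglongrightarrow> x"
proof -
  have sub: "cball a (r / 2) \<subseteq> ball a r"
    using pos by auto
  have "\<forall>n. approx n s \<in> N"
    using approx_in_cball[OF s] sub complete(2) by blast
  then have "\<exists>x\<in>N. (\<lambda>n. approx n s) \<longlonglongrightarrow> x"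
    using complete(1)[unfolded complete_def, rule_format, of "\<lambda>n. approx n s"] approx_Cauchy[OF s] by blast
  then obtain x where x: "(\<lambda>n. approx n s) \<longlonglongrightarrow> x"
    by blast
  have "x \<in> cball a (r / 2)"
    by (rule closed_sequentially[OF closed_cball approx_in_cball[OF s] x])
  with x sub show ?thesis by blast
qed

definition curve :: "real \<Rightarrow> 'a" where
  "curve s = lim (\<lambda>n. approx n s)"

lemma approx_tendsto:
  assumes "s \<in> {t..t + e}"
  shows "(\<lambda>n. approx n s) \<longlonglongrightarrow> curve s" "curve s \<in> ball a r"
  using approx_convergent[OF assms] unfolding curve_def by (auto dest: limI)

section \<open>Tangency of the limit curve\<close>

text \<open>The arguments are exchanged one at a time: first the step by \<open>speed\<close>, then
  the point by \<open>lip\<close>, finally the time by \<open>time\<close>. The step goes first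
  because the \<open>hn n\<close> are only known to lie in \<open>{0..1}\<close>, whereas
  \<open>lip\<close> and \<open>time\<close> need a step in \<open>{0..e}\<close>.\<close>

lemma flow_tendsto:
  assumes s: "s \<in> {t..t + e}" and h: "h \<in> {0..e}"
    and sn: "sn \<longlonglongrightarrow> s" "\<And>n. sn n \<in> {t..t + e}"
    and hn: "hn \<longlonglongrightarrow> h" "\<And>n. hn n \<in> {0..1}"
    and xn: "xn \<longlonglongrightarrow> x" "\<And>n. xn n \<in> ball a r" and x: "x \<in> ball a r"
  shows "(\<lambda>n. \<Phi> (sn n) (xn n) (hn n)) \<longlonglongrightarrow> \<Phi> s x h"
proof -
  have h1: "h \<in> {0..1}" using h pos by auto
  have T: "(\<lambda>n. dist (\<Phi> (sn n) x h) (\<Phi> s x h)) \<longlonglongrightarrow> 0"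
  proof (rule tendstoI)
    fix \<epsilon> :: real assume "0 < \<epsilon>"
    then obtain h0 where h0: "h0 > 0" "\<And>s'. \<lbrakk>s' \<in> {t..t + e}; \<bar>s' - s\<bar> < h0\<rbrakk> \<Longrightarrow> dist (\<Phi> s' x h) (\<Phi> s x h) \<le> h * (\<epsilon> / 2)"
      using time[of "\<epsilon> / 2"] x h s by (meson half_gt_zero)
    have less: "h * (\<epsilon> / 2) < \<epsilon>"
      using h1 \<open>0 < \<epsilon>\<close> mult_right_mono[of h 1 "\<epsilon> / 2"] by simp
    have "dist (dist (\<Phi> (sn n) x h) (\<Phi> s x h)) 0 < \<epsilon>" if "dist (sn n) s < h0" for n
      using le_less_trans[OF h0(2)[OF sn(2)] less, of n] that by (simp add: dist_real_def)
    with tendstoD[OF sn(1) h0(1)]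
    show "\<forall>\<^sub>F n in sequentially. dist (dist (\<Phi> (sn n) x h) (\<Phi> s x h)) 0 < \<epsilon>"
      by (rule eventually_mono)
  qed
  have bound: "dist (\<Phi> (sn n) (xn n) (hn n)) (\<Phi> s x h)
      \<le> R * \<bar>hn n - h\<bar> + (1 + h * L) * dist (xn n) x + dist (\<Phi> (sn n) x h) (\<Phi> s x h)" for n
    using speed[OF xn(2) sn(2) hn(2) h1, of n n n] lip[OF xn(2) x sn(2) h, of n n]
      dist_triangle[of "\<Phi> (sn n) (xn n) (hn n)" "\<Phi> s x h" "\<Phi> (sn n) (xn n) h"]
      dist_triangle[of "\<Phi> (sn n) (xn n) h" "\<Phi> s x h" "\<Phi> (sn n) x h"] by linarith
  define B where "B n = R * \<bar>hn n - h\<bar> + (1 + h * L) * dist (xn n) x + dist (\<Phi> (sn n) x h) (\<Phi> s x h)" for n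
  have "B \<longlonglongrightarrow> R * \<bar>h - h\<bar> + (1 + h * L) * dist x x + 0"
    unfolding B_def by (intro tendsto_intros hn(1) xn(1) T)
  then have "B \<longlonglongrightarrow> 0" by simp
  then have "(\<lambda>n. dist (\<Phi> (sn n) (xn n) (hn n)) (\<Phi> s x h)) \<longlonglongrightarrow> 0"
    by (rule Lim_null_comparison[rotated]) (simp add: B_def bound)
  then show ?thesis
    by (rule iffD2[OF tendsto_dist_iff])
qed

text \<open>The polygon estimate between the nodes below \<open>s\<close> and \<open>s + h\<close>
  is passed to the limit in the mesh. This works because its threshold is the same for all
  meshes.\<close>

lemma curve_tangent:
  assumes "0 < \<delta>"
  shows "\<exists>h0>0. \<forall>s h. t \<le> s \<longrightarrow> s + h \<le> t + e \<longrightarrow> 0 < h \<longrightarrow> h < h0 \<longrightarrow>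
    dist (curve (s + h)) (\<Phi> s (curve s) h) \<le> \<delta> * h"
proof -
  obtain h0 where h0: "h0 > 0" "\<And>n i m. \<lbrakk>real (i + m) / 2 ^ n \<le> e; real m / 2 ^ n < h0\<rbrakk> \<Longrightarrow>
      dist (\<Phi> (t + real i / 2 ^ n) (euler n i) (real m / 2 ^ n)) (euler n (i + m)) \<le> \<delta> * (real m / 2 ^ n)"
    using euler_tangent[OF assms] by blast
  have main: "dist (curve (s + h)) (\<Phi> s (curve s) h) \<le> \<delta> * h"
    if s: "t \<le> s" "s + h \<le> t + e" and h: "0 < h" "h < h0" for s h
  proof -
    have dom: "s \<in> {t..t + e}" "s + h \<in> {t..t + e}" "h \<in> {0..e}"
      using s h by auto
    define i where "i n = idx n s" for n
    \<comment> \<open>The number of steps between the two rounded times. Monotonicity of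
      \<open>idx\<close> makes the subtraction exact, and \<open>m n / 2 ^ n\<close> tends to
      \<open>h\<close> as the rounding errors vanish.\<close>
    define m where "m n = idx n (s + h) - i n" for n
    have im: "idx n (s + h) = i n + m n" for n
      using idx_mono[of s "s + h" n] h by (simp add: m_def i_def)
    have node: "real (i n) / 2 ^ n \<le> e" "real (i n + m n) / 2 ^ n \<le> e" for n
      using idx_bounds(1)[of s n] idx_bounds(1)[of "s + h" n] s h unfolding i_def[symmetric] im by auto
    have m_le: "real (m n) / 2 ^ n \<in> {0..1}" for n
    proof -
      have "real (m n) / 2 ^ n \<le> real (i n + m n) / 2 ^ n"
        by (intro divide_right_mono) auto
      then have "real (m n) / 2 ^ n \<le> 1" using node(2)[of n] pos by linarith
      then show ?thesis by simp
    qed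
    have "(\<lambda>n. real (idx n (s + h)) / 2 ^ n - real (i n) / 2 ^ n) \<longlonglongrightarrow> (s + h - t) - (s - t)"
      using s h unfolding i_def by (intro tendsto_diff idx_tendsto) auto
    then have hn: "(\<lambda>n. real (m n) / 2 ^ n) \<longlonglongrightarrow> h"
      by (simp add: im add_divide_distrib)
    have "(\<lambda>n. t + real (i n) / 2 ^ n) \<longlonglongrightarrow> t + (s - t)"
      unfolding i_def by (intro tendsto_intros idx_tendsto s)
    then have sn: "(\<lambda>n. t + real (i n) / 2 ^ n) \<longlonglongrightarrow> s"
      by simp
    have "(\<lambda>n. \<Phi> (t + real (i n) / 2 ^ n) (euler n (i n)) (real (m n) / 2 ^ n)) \<longlonglongrightarrow> \<Phi> s (curve s) h"
    proof (rule flow_tendsto[OF dom(1,3) sn _ hn m_le])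
      show "t + real (i n) / 2 ^ n \<in> {t..t + e}" for n
        using node_in[OF node(1)] .
      show "(\<lambda>n. euler n (i n)) \<longlonglongrightarrow> curve s" "curve s \<in> ball a r"
        using approx_tendsto[OF dom(1)] by (simp_all add: approx_def i_def)
      show "euler n (i n) \<in> ball a r" for n
        using euler_in_ball[OF node(1)] .
    qed
    moreover have "(\<lambda>n. euler n (i n + m n)) \<longlonglongrightarrow> curve (s + h)"
      using approx_tendsto(1)[OF dom(2)] by (simp add: approx_def im)
    ultimately have lhs: "(\<lambda>n. dist (\<Phi> (t + real (i n) / 2 ^ n) (euler n (i n)) (real (m n) / 2 ^ n)) (euler n (i n + m n)))
        \<longlonglongrightarrow> dist (\<Phi> s (curve s) h) (curve (s + h))"
      by (rule tendsto_dist)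
    have rhs: "(\<lambda>n. \<delta> * (real (m n) / 2 ^ n)) \<longlonglongrightarrow> \<delta> * h"
      by (intro tendsto_intros hn)
    \<comment> \<open>The strict inequality \<open>h < h0\<close> is inherited by the approximating
      step lengths from some \<open>n\<close> on.\<close>
    have "\<forall>\<^sub>F n in sequentially. real (m n) / 2 ^ n < h0"
      using order_tendstoD(2)[OF hn h(2)] .
    then have "\<forall>\<^sub>F n in sequentially.
        dist (\<Phi> (t + real (i n) / 2 ^ n) (euler n (i n)) (real (m n) / 2 ^ n)) (euler n (i n + m n)) \<le> \<delta> * (real (m n) / 2 ^ n)"
      by (rule eventually_mono) (rule h0(2)[OF node(2)])
    from tendsto_le[OF _ rhs lhs this] show ?thesis
      by (simp add: dist_commute)
  qed
  show ?thesis
    using h0(1) main by blast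
qed

lemma curve_solution: "solution_curve \<Phi> a t e curve"
  unfolding solution_curve_def
proof (intro conjI ballI)
  \<comment> \<open>At time \<open>t\<close> the index is 0 on every grid, so the sequence is
    constantly \<open>a\<close>.\<close>
  have "(\<lambda>n. approx n t) \<longlonglongrightarrow> a"
    by (simp add: approx_def idx_def)
  then show "curve t = a"
    unfolding curve_def by (rule limI)
next
  fix s assume s: "s \<in> {t..<t + e}"
  show "((\<lambda>h. dist (curve (s + h)) (\<Phi> s (curve s) h) / h) \<longlongrightarrow> 0) (at_right 0)"
  proof (rule tendstoI)
    fix \<epsilon> :: real assume "0 < \<epsilon>"
    then obtain h0 where h0: "h0 > 0" "\<And>h. \<lbrakk>s + h \<le> t + e; 0 < h; h < h0\<rbrakk> \<Longrightarrow>
        dist (curve (s + h)) (\<Phi> s (curve s) h) \<le> \<epsilon> / 2 * h"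
      using curve_tangent[of "\<epsilon> / 2"] s by (meson atLeastLessThan_iff half_gt_zero)
    have "dist (dist (curve (s + h)) (\<Phi> s (curve s) h) / h) 0 < \<epsilon>"
      if "0 < h" "h < min h0 (t + e - s)" for h
    proof -
      have "dist (curve (s + h)) (\<Phi> s (curve s) h) / h \<le> \<epsilon> / 2"
        using h0(2)[of h] that by (simp add: divide_le_eq)
      also have "\<dots> < \<epsilon>"
        using \<open>0 < \<epsilon>\<close> by simp
      finally show ?thesis
        using that by simp
    qed
    then show "\<forall>\<^sub>F h in at_right 0. dist (dist (curve (s + h)) (\<Phi> s (curve s) h) / h) 0 < \<epsilon>"
      unfolding eventually_at_right_field
      using h0(1) s by (intro exI[of _ "min h0 (t + e - s)"]) auto
  qed
qed

end

section \<open>Local estimates from the arc field axioms and Conditions A, B, C\<close>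

lemma arc_field_speed:
  assumes "time_dependent_arc_field \<Phi>" "0 \<le> t"
  obtains r l R where "0 < r" "0 < l" "0 < R"
    "\<And>x s h k. \<lbrakk>x \<in> ball a r; 0 \<le> s; \<bar>t - s\<bar> \<le> l; h \<in> {0..1}; k \<in> {0..1}\<rbrakk> \<Longrightarrow>
        dist (\<Phi> s x h) (\<Phi> s x k) \<le> R * \<bar>h - k\<bar>"
proof -
  obtain r l where rl: "0 < r" "0 < l" "local_arc_speed \<Phi> a t r l < \<infinity>"
    using assms unfolding time_dependent_arc_field_def by blast
  obtain R where R: "local_arc_speed \<Phi> a t r l \<le> ereal R"
    using rl(3) by (cases "local_arc_speed \<Phi> a t r l") auto
  show ?thesis
  \<comment> \<open>The bound on the speed may be 0; a positive one is wanted because the length of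
    the time interval is later limited by \<open>r / (2 * R)\<close>.\<close>
  proof (rule that[of r l "max R 1"])
    fix x s and h k :: real
    assume x: "x \<in> ball a r" and s: "0 \<le> s" "\<bar>t - s\<bar> \<le> l" and hk: "h \<in> {0..1}" "k \<in> {0..1}"
    show "dist (\<Phi> s x h) (\<Phi> s x k) \<le> max R 1 * \<bar>h - k\<bar>"
    proof (cases "h = k")
      case False
      have "ereal (dist (\<Phi> s x h) (\<Phi> s x k) / \<bar>h - k\<bar>) \<le> arc_speed \<Phi> x s"
        unfolding arc_speed_def using hk False by (intro SUP_upper2[of "(h, k)"]) auto
      also have "\<dots> \<le> local_arc_speed \<Phi> a t r l"
        unfolding local_arc_speed_def using x s by (intro SUP_upper2[of "(x, s)"]) auto
      also have "\<dots> \<le> ereal R" by (rule R)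
      finally have "dist (\<Phi> s x h) (\<Phi> s x k) \<le> R * \<bar>h - k\<bar>"
        using False by (simp add: divide_le_eq)
      also have "\<dots> \<le> max R 1 * \<bar>h - k\<bar>"
        by (intro mult_right_mono) auto
      finally show ?thesis .
    qed simp
  qed (use rl in auto)
qed

lemma condition_A_local:
  assumes "condition_A \<Phi>" "0 \<le> t"
  obtains r \<epsilon> T L where "0 < r" "0 < \<epsilon>" "t < T" "0 \<le> L"
    "\<And>x y h s. \<lbrakk>x \<in> ball a r; y \<in> ball a r; h \<in> {0..\<epsilon>}; s \<in> {t..T}\<rbrakk> \<Longrightarrow>
        dist (\<Phi> s x h) (\<Phi> s y h) \<le> (1 + h * L) * dist x y"
proof -
  obtain \<Lambda> r \<epsilon> T where *: "0 < r" "\<epsilon> \<in> {0<..1}" "t < T"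
      "bdd_above ((\<lambda>(x, y, h). \<Lambda> x y h) ` (ball a r \<times> ball a r \<times> {0..\<epsilon>}))"
      "\<And>x y h s. \<lbrakk>x \<in> ball a r; y \<in> ball a r; h \<in> {0..\<epsilon>}; s \<in> {t..T}\<rbrakk> \<Longrightarrow>
        dist (\<Phi> s x h) (\<Phi> s y h) \<le> dist x y * (1 + h * (\<Lambda> x y h :: real))"
    using assms unfolding condition_A_def by metis
  from *(4) obtain L where L: "\<And>x y h. \<lbrakk>x \<in> ball a r; y \<in> ball a r; h \<in> {0..\<epsilon>}\<rbrakk> \<Longrightarrow> \<Lambda> x y h \<le> L"
    unfolding bdd_above_def by force
  show ?thesis
  \<comment> \<open>An upper bound of \<open>\<Lambda>\<close> may be negative, while the Gronwall
    argument works with a nonnegative rate.\<close>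
  proof (rule that[of r \<epsilon> T "max L 0"])
    fix x y h s
    assume xy: "x \<in> ball a r" "y \<in> ball a r" and h: "h \<in> {0..\<epsilon>}" and s: "s \<in> {t..T}"
    have "dist (\<Phi> s x h) (\<Phi> s y h) \<le> dist x y * (1 + h * \<Lambda> x y h)"
      using *(5)[OF xy h s] .
    also have "\<dots> \<le> dist x y * (1 + h * max L 0)"
      using L[OF xy h] h by (intro mult_left_mono add_left_mono) auto
    finally show "dist (\<Phi> s x h) (\<Phi> s y h) \<le> (1 + h * max L 0) * dist x y"
      by (simp add: mult.commute)
  qed (use * in auto)
qed

text \<open>With \<open>\<Omega>\<close> bounded by \<open>M\<close>, it is enough that
  \<open>g\<close> falls below \<open>\<delta> / M\<close>. Convergence along the product filter
  provides this for all small positive \<open>l\<close> and \<open>h\<close>, independently of each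
  other.\<close>

lemma condition_B_local:
  assumes "condition_B \<Phi>" "0 \<le> t"
  obtains r T where "0 < r" "t < T"
    "\<forall>\<delta>>0. \<exists>h0>0. \<forall>x\<in>ball a r. \<forall>s\<in>{t..T}. \<forall>l\<in>{0<..<h0}. \<forall>h\<in>{0<..<h0}.
        dist (\<Phi> s x (l + h)) (\<Phi> s (\<Phi> s x l) h) \<le> h * \<delta>"
proof -
  obtain \<Omega> where \<Omega>: "\<And>x l h. \<lbrakk>l \<in> {0..1}; h \<in> {0..1}\<rbrakk> \<Longrightarrow> (0 :: real) \<le> \<Omega> x l h"
    "\<exists>r>0. \<exists>\<epsilon>\<in>{0<..1}. \<exists>T>t. \<exists>g :: real \<Rightarrow> real \<Rightarrow> real.
          bounded ((\<lambda>(x, l, h). \<Omega> x l h) ` (ball a r \<times> {0..\<epsilon>} \<times> {0..\<epsilon>})) \<and>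
          (\<forall>l\<in>{0..\<epsilon>}. \<forall>h\<in>{0..\<epsilon>}. 0 \<le> g l h) \<and>
          ((\<lambda>(l, h). g l h) \<longlongrightarrow> 0) (at_right 0 \<times>\<^sub>F at_right 0) \<and>
          (\<lambda>i. g ((1/2) ^ i) ((1/2) ^ i)) summable_on {i::nat. 1 \<le> i \<and> (1/2) ^ i \<le> \<epsilon>} \<and>
          (\<forall>b\<in>ball a r. \<forall>l\<in>{0..\<epsilon>}. \<forall>h\<in>{0..\<epsilon>}. \<forall>s\<in>{t..T}. l + h \<le> 1 \<longrightarrow>
             dist (\<Phi> s b (l + h)) (\<Phi> s (\<Phi> s b l) h) \<le> h * g l h * \<Omega> b l h)"
    using assms unfolding condition_B_def by blast
  then obtain r \<epsilon> T g where *: "0 < r" "\<epsilon> \<in> {0<..1}" "t < T"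
      "bounded ((\<lambda>(x, l, h). \<Omega> x l h) ` (ball a r \<times> {0..\<epsilon>} \<times> {0..\<epsilon>}))"
      "\<And>l h. \<lbrakk>l \<in> {0..\<epsilon>}; h \<in> {0..\<epsilon>}\<rbrakk> \<Longrightarrow> (0 :: real) \<le> g l h"
      "((\<lambda>(l, h). g l h) \<longlongrightarrow> 0) (at_right (0 :: real) \<times>\<^sub>F at_right (0 :: real))"
      "\<And>b l h s. \<lbrakk>b \<in> ball a r; l \<in> {0..\<epsilon>}; h \<in> {0..\<epsilon>}; s \<in> {t..T}; l + h \<le> 1\<rbrakk> \<Longrightarrow>
        dist (\<Phi> s b (l + h)) (\<Phi> s (\<Phi> s b l) h) \<le> h * g l h * \<Omega> b l h"
    by blast
  from *(4) obtain M where M: "0 < M" "\<And>x l h. \<lbrakk>x \<in> ball a r; l \<in> {0..\<epsilon>}; h \<in> {0..\<epsilon>}\<rbrakk> \<Longrightarrow> \<bar>\<Omega> x l h\<bar> \<le> M"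
    unfolding bounded_pos by force
  show ?thesis
  proof (rule that[OF *(1,3)], intro allI impI)
    fix \<delta> :: real assume "0 < \<delta>"
    then have "0 < \<delta> / M" using M by simp
    then have "\<forall>\<^sub>F lh in at_right 0 \<times>\<^sub>F at_right 0. (\<lambda>(l, h). g l h) lh < \<delta> / M"
      by (rule order_tendstoD(2)[OF *(6)])
    then obtain P Q where PQ: "eventually P (at_right (0 :: real))" "eventually Q (at_right (0 :: real))"
        "\<And>l h. P l \<Longrightarrow> Q h \<Longrightarrow> g l h < \<delta> / M"
      unfolding eventually_prod_filter by auto
    obtain h1 h2 where h12: "h1 > 0" "h2 > 0" "\<And>l. 0 < l \<Longrightarrow> l < h1 \<Longrightarrow> P l" "\<And>h. 0 < h \<Longrightarrow> h < h2 \<Longrightarrow> Q h"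
      using PQ(1,2) unfolding eventually_at_right_field by blast
    \<comment> \<open>The cap \<open>1 / 2\<close> secures the side condition
      \<open>l + h \<le> 1\<close>, and \<open>\<epsilon>\<close> the domain of the
      estimate.\<close>
    define h0 where "h0 = min (min h1 h2) (min \<epsilon> (1 / 2))"
    have "dist (\<Phi> s x (l + h)) (\<Phi> s (\<Phi> s x l) h) \<le> h * \<delta>"
      if x: "x \<in> ball a r" and s: "s \<in> {t..T}" and "l \<in> {0<..<h0}" "h \<in> {0<..<h0}" for x s l h
    proof -
      have lh: "l \<in> {0..\<epsilon>}" "h \<in> {0..\<epsilon>}" "l + h \<le> 1" "0 < l" "0 < h" "P l" "Q h"
        using that h12 by (auto simp: h0_def)
      have "dist (\<Phi> s x (l + h)) (\<Phi> s (\<Phi> s x l) h) \<le> h * g l h * \<Omega> x l h"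
        using *(7)[OF x lh(1,2) s lh(3)] .
      also have "\<dots> = h * (g l h * \<Omega> x l h)"
        by simp
      also have "\<dots> \<le> h * (\<delta> / M * M)"
        using *(5)[OF lh(1,2)] M(2)[OF x lh(1,2)] PQ(3)[OF lh(6,7)] lh(5) \<Omega>(1)[of l h x] lh(1,2) *(2)
        by (intro mult_left_mono mult_mono) auto
      finally show ?thesis using M by simp
    qed
    moreover have "h0 > 0" using h12 *(2) by (simp add: h0_def)
    ultimately show "\<exists>h0>0. \<forall>x\<in>ball a r. \<forall>s\<in>{t..T}. \<forall>l\<in>{0<..<h0}. \<forall>h\<in>{0<..<h0}.
        dist (\<Phi> s x (l + h)) (\<Phi> s (\<Phi> s x l) h) \<le> h * \<delta>"
      by blast
  qed
qed

lemma condition_C_local: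
  assumes "condition_C \<Phi>" "0 \<le> t"
  obtains r \<epsilon> T where "0 < r" "0 < \<epsilon>" "t < T"
    "\<forall>\<delta>>0. \<exists>h0>0. \<forall>x\<in>ball a r. \<forall>h\<in>{0..\<epsilon>}. \<forall>s1\<in>{t..T}. \<forall>s2\<in>{t..T}.
        \<bar>s1 - s2\<bar> < h0 \<longrightarrow> dist (\<Phi> s1 x h) (\<Phi> s2 x h) \<le> h * \<delta>"
proof -
  have "\<exists>r>0. \<exists>\<epsilon>\<in>{0<..1}. \<exists>T>t. \<exists>\<alpha>\<in>{0<..<1}. \<exists>C>0.
      \<forall>b\<in>ball a r. \<forall>h\<in>{0..\<epsilon>}. \<forall>s1\<in>{t..T}. \<forall>s2\<in>{t..T}.
        dist (\<Phi> s1 b h) (\<Phi> s2 b h) \<le> C * h * \<bar>s1 - s2\<bar> powr \<alpha>"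
    using assms unfolding condition_C_def by blast
  then obtain r \<epsilon> T \<alpha> C where *: "0 < r" "\<epsilon> \<in> {0<..1}" "t < T" "\<alpha> \<in> {0<..<1}" "0 < C"
      "\<And>b h s1 s2. \<lbrakk>b \<in> ball a r; h \<in> {0..\<epsilon>}; s1 \<in> {t..T}; s2 \<in> {t..T}\<rbrakk> \<Longrightarrow>
        dist (\<Phi> s1 b h) (\<Phi> s2 b h) \<le> C * h * \<bar>s1 - s2\<bar> powr \<alpha>"
    by blast
  then have \<epsilon>: "0 < \<epsilon>" by simp
  show ?thesis
  proof (rule that[OF *(1) \<epsilon> *(3)], intro allI impI)
    fix \<delta> :: real assume "0 < \<delta>"
    \<comment> \<open>The solution of \<open>C * h0 powr \<alpha> = \<delta>\<close>, which turns
      the Hoelder bound into a modulus of continuity.\<close>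
    define h0 where "h0 = (\<delta> / C) powr (1 / \<alpha>)"
    have h0: "h0 > 0" "h0 powr \<alpha> = \<delta> / C"
      using \<open>0 < \<delta>\<close> * by (auto simp: h0_def powr_powr)
    have "dist (\<Phi> s1 x h) (\<Phi> s2 x h) \<le> h * \<delta>"
      if x: "x \<in> ball a r" and h: "h \<in> {0..\<epsilon>}" and s: "s1 \<in> {t..T}" "s2 \<in> {t..T}" "\<bar>s1 - s2\<bar> < h0" for x h s1 s2
    proof -
      have "dist (\<Phi> s1 x h) (\<Phi> s2 x h) \<le> C * h * \<bar>s1 - s2\<bar> powr \<alpha>"
        using *(6)[OF x h s(1,2)] .
      also have "\<dots> \<le> C * h * h0 powr \<alpha>"
        using * s h by (intro mult_left_mono powr_mono2) auto
      finally show ?thesis using *(5) h0 by simp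
    qed
    then show "\<exists>h0>0. \<forall>x\<in>ball a r. \<forall>h\<in>{0..\<epsilon>}. \<forall>s1\<in>{t..T}. \<forall>s2\<in>{t..T}.
        \<bar>s1 - s2\<bar> < h0 \<longrightarrow> dist (\<Phi> s1 x h) (\<Phi> s2 x h) \<le> h * \<delta>"
      using h0(1) by blast
  qed
qed

section \<open>Common constants and existence of the solution\<close>

theorem theorem2p9:
  fixes \<Phi> :: "real \<Rightarrow> 'a::metric_space \<Rightarrow> real \<Rightarrow> 'a"
  assumes "locally_complete (UNIV :: 'a set)"
    and "time_dependent_arc_field \<Phi>"
    and "condition_A \<Phi>"
    and "condition_B \<Phi>"
    and "condition_C \<Phi>"
  shows "\<forall>a. \<forall>t\<ge>0. \<exists>c>0. \<exists>\<sigma>. solution_curve \<Phi> a t c \<sigma>"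
proof (intro allI impI)
  fix a :: 'a and t :: real assume t: "0 \<le> t"
  have "\<exists>N. complete N \<and> (\<exists>U. open U \<and> a \<in> U \<and> U \<subseteq> N)"
    using assms(1) by (simp add: locally_complete_def)
  then obtain N U where N: "complete N" "open U" "a \<in> U" "U \<subseteq> N"
    by blast
  then obtain r0 where r0: "0 < r0" "ball a r0 \<subseteq> N"
    by (meson open_contains_ball subset_trans)
  obtain r1 l R where S: "0 < r1" "0 < l" "0 < R"
    "\<And>x s h k. \<lbrakk>x \<in> ball a r1; 0 \<le> s; \<bar>t - s\<bar> \<le> l; h \<in> {0..1}; k \<in> {0..1}\<rbrakk> \<Longrightarrow>
        dist (\<Phi> s x h) (\<Phi> s x k) \<le> R * \<bar>h - k\<bar>"
    using arc_field_speed[OF assms(2) t] by metis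
  obtain rA eA TA L where A: "0 < rA" "0 < eA" "t < TA" "0 \<le> L"
    "\<And>x y h s. \<lbrakk>x \<in> ball a rA; y \<in> ball a rA; h \<in> {0..eA}; s \<in> {t..TA}\<rbrakk> \<Longrightarrow>
        dist (\<Phi> s x h) (\<Phi> s y h) \<le> (1 + h * L) * dist x y"
    using condition_A_local[OF assms(3) t] by metis
  obtain rB TB where B: "0 < rB" "t < TB"
    "\<forall>\<delta>>0. \<exists>h0>0. \<forall>x\<in>ball a rB. \<forall>s\<in>{t..TB}. \<forall>l\<in>{0<..<h0}. \<forall>h\<in>{0<..<h0}.
        dist (\<Phi> s x (l + h)) (\<Phi> s (\<Phi> s x l) h) \<le> h * \<delta>"
    by (rule condition_B_local[OF assms(4) t, of a])
  obtain rC eC TC where C: "0 < rC" "0 < eC" "t < TC"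
    "\<forall>\<delta>>0. \<exists>h0>0. \<forall>x\<in>ball a rC. \<forall>h\<in>{0..eC}. \<forall>s1\<in>{t..TC}. \<forall>s2\<in>{t..TC}.
        \<bar>s1 - s2\<bar> < h0 \<longrightarrow> dist (\<Phi> s1 x h) (\<Phi> s2 x h) \<le> h * \<delta>"
    by (rule condition_C_local[OF assms(5) t, of a])
  define r where "r = Min {r0, r1, rA, rB, rC}"
  \<comment> \<open>This one number bounds both steps and elapsed time: 1 serves Gronwall,
    \<open>l\<close> and the three differences the time windows, \<open>eA\<close> and
    \<open>eC\<close> the step ranges, and \<open>r / (2 * R)\<close> gives
    \<open>R * e \<le> r / 2\<close>.\<close>
  define e where "e = Min {1, l, eA, eC, TA - t, TB - t, TC - t, r / (2 * R)}"
  have r: "0 < r" "r \<le> r0" "r \<le> r1" "r \<le> rA" "r \<le> rB" "r \<le> rC"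
    using r0(1) S(1) A(1) B(1) C(1) by (auto simp: r_def)
  have e: "0 < e" "e \<le> 1" "e \<le> l" "e \<le> eA" "e \<le> eC" "t + e \<le> TA" "t + e \<le> TB" "t + e \<le> TC" "e \<le> r / (2 * R)"
  proof -
    show "0 < e"
      using r(1) S(2,3) A(2,3) B(2) C(2,3) unfolding e_def by (subst Min_gr_iff) auto
    have le: "e \<le> y" if "y \<in> {1, l, eA, eC, TA - t, TB - t, TC - t, r / (2 * R)}" for y
      unfolding e_def using that by (intro Min_le) auto
    show "e \<le> 1" "e \<le> l" "e \<le> eA" "e \<le> eC" "e \<le> r / (2 * R)"
      by (rule le, simp)+
    show "t + e \<le> TA" "t + e \<le> TB" "t + e \<le> TC"
      using le[of "TA - t"] le[of "TB - t"] le[of "TC - t"] by simp_all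
  qed
  interpret uniform_arc_field \<Phi> a t r e R L N
  proof
    show "R * e \<le> r / 2"
      using e(9) S(3) by (simp add: field_simps)
    show "\<Phi> s x 0 = x" if "t \<le> s" for s x
      using assms(2) that t unfolding time_dependent_arc_field_def by (meson order_trans)
    show "dist (\<Phi> s x h) (\<Phi> s x k) \<le> R * \<bar>h - k\<bar>"
      if "x \<in> ball a r" "s \<in> {t..t + e}" "h \<in> {0..1}" "k \<in> {0..1}" for s x h k
      using that r(3) e(3) t by (intro S(4)) auto
    show "dist (\<Phi> s x h) (\<Phi> s y h) \<le> (1 + h * L) * dist x y"
      if "x \<in> ball a r" "y \<in> ball a r" "s \<in> {t..t + e}" "h \<in> {0..e}" for s x y h
      using that r(4) e(4,6) by (intro A(5)) auto
    show "\<exists>h0>0. \<forall>x\<in>ball a r. \<forall>s\<in>{t..t + e}. \<forall>l\<in>{0<..<h0}. \<forall>h\<in>{0<..<h0}.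
        dist (\<Phi> s x (l + h)) (\<Phi> s (\<Phi> s x l) h) \<le> h * \<delta>" if "0 < \<delta>" for \<delta>
    proof -
      obtain h0 where "h0 > 0" and h0: "\<And>x s l h. \<lbrakk>x \<in> ball a rB; s \<in> {t..TB}; l \<in> {0<..<h0}; h \<in> {0<..<h0}\<rbrakk> \<Longrightarrow>
          dist (\<Phi> s x (l + h)) (\<Phi> s (\<Phi> s x l) h) \<le> h * \<delta>"
        using B(3)[rule_format, OF \<open>0 < \<delta>\<close>] by blast
      show ?thesis
        by (intro exI[of _ h0] conjI ballI h0 \<open>h0 > 0\<close>) (use r(5) e(7) in auto)
    qed
    show "\<exists>h0>0. \<forall>x\<in>ball a r. \<forall>h\<in>{0..e}. \<forall>s1\<in>{t..t + e}. \<forall>s2\<in>{t..t + e}.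
        \<bar>s1 - s2\<bar> < h0 \<longrightarrow> dist (\<Phi> s1 x h) (\<Phi> s2 x h) \<le> h * \<delta>" if "0 < \<delta>" for \<delta>
    proof -
      obtain h0 where "h0 > 0" and h0: "\<And>x h s1 s2. \<lbrakk>x \<in> ball a rC; h \<in> {0..eC}; s1 \<in> {t..TC}; s2 \<in> {t..TC}; \<bar>s1 - s2\<bar> < h0\<rbrakk> \<Longrightarrow>
          dist (\<Phi> s1 x h) (\<Phi> s2 x h) \<le> h * \<delta>"
        using C(4)[rule_format, OF \<open>0 < \<delta>\<close>] by blast
      show ?thesis
        by (intro exI[of _ h0] conjI ballI impI h0 \<open>h0 > 0\<close>) (use r(6) e(5,8) in auto)
    qed
    show "ball a r \<subseteq> N"
      using r0(2) r(2) by (meson subset_ball subset_trans)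
  qed (use r(1) e(1,2) S(3) A(4) N(1) in auto)
  show "\<exists>c>0. \<exists>\<sigma>. solution_curve \<Phi> a t c \<sigma>"
    using curve_solution e(1) by blast
qed

end
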